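(* If $X$ is a connected, uniformly locally pathwise connected uniform space, then $X$ is coverable. In particular, every compact, connected, locally pathwise connected topological space is coverable.
   Context: All entourages are taken to be symmetric; $B(x,E)=\{y:(x,y)\in E\}$ is the $E$-ball at $x$. $X$ is uniformly locally pathwise connected if for each entourage $E$ there is an entourage $F\subset E$ such that all $F$-balls are open and pathwise connected. Compact topological spaces are (Hausdorff and) given the unique uniformity compatible with their topology. Fix a basepoint $*\in X$. For an entourage $E$ of $X$, an $E$-chain from $p$ to $q$ is a finite sequence $\{x_0=p,\dots,x_n=q\}$ with $(x_i,x_{i+1})\in E$ for all $i$. Two $E$-chains with the same endpoints are $E$-homotopic if one is obtained from the other in finitely many steps, each adding or removing a single point, always keeping the endpoints fixed and keeping an $E$-chain at each stage (in particular $\{p\}$ and $\{p,p\}$ are $E$-homotopic); $[\alpha]_E$ is the class of $\alpha$. $X_E$ is the set of $E$-homotopy classes of $E$-chains starting at $*$. For an entourage $D\subset E$ let $D^*$ be the set of pairs $([*=x_0,\dots,x_n,y]_E,[*=x_0,\dots,x_n,z]_E)$ with $(y,z)\in D$; $X_E$ carries the uniformity with base $\{D^*:D\subset E\}$. For $D\subset E$, $\phi_{ED}:X_D\to X_E$ is $[\alpha]_D\mapsto[\alpha]_E$. $\widetilde{X}=\varprojlim X_E$ (over all entourages, ordered by reverse inclusion, with the inverse limit uniformity), with projections $\phi_E:\widetilde{X}\to X_E$. $X$ is coverable if its uniformity has a base, containing $X\times X$, of entourages $E$ for which $\phi_E$ is surjective. *)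

theory Defs
  imports "HOL-Analysis.Analysis"
begin

text \<open>
  The uniformity is an explicit parameter \<open>U\<close>, so that the same notions apply to the uniformity
  of a \<open>uniform_space\<close> type and to the one induced by a compact Hausdorff topology.
\<close>

definition entourage :: "('a \<times> 'a) filter \<Rightarrow> ('a \<times> 'a) set \<Rightarrow> bool" where
  "entourage U E \<longleftrightarrow> (\<forall>\<^sub>F p in U. p \<in> E) \<and> sym E"

definition eball :: "'a \<Rightarrow> ('a \<times> 'a) set \<Rightarrow> 'a set" where
  "eball x E = {y. (x, y) \<in> E}"

definition uniformly_locally_path_connected :: "('a::topological_space \<times> 'a) filter \<Rightarrow> bool" where
  "uniformly_locally_path_connected U \<longleftrightarrow>
     (\<forall>E. entourage U E \<longrightarrow>
        (\<exists>F. entourage U F \<and> F \<subseteq> E \<and> (\<forall>x. open (eball x F) \<and> path_connected (eball x F))))"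


subsection \<open>Chains and their homotopies\<close>

definition chain :: "('a \<times> 'a) set \<Rightarrow> 'a \<Rightarrow> 'a \<Rightarrow> 'a list \<Rightarrow> bool" where
  "chain E p q xs \<longleftrightarrow>
     xs \<noteq> [] \<and> hd xs = p \<and> last xs = q \<and> successively (\<lambda>x y. (x, y) \<in> E) xs"

definition chain_insert :: "('a \<times> 'a) set \<Rightarrow> 'a list \<Rightarrow> 'a list \<Rightarrow> bool" where
  "chain_insert E xs ys \<longleftrightarrow>
     (\<exists>p q. chain E p q xs \<and> chain E p q ys) \<and>
     (\<exists>us y ws. xs = us @ ws \<and> ys = us @ [y] @ ws)"

definition chains_from :: "('a \<times> 'a) set \<Rightarrow> 'a \<Rightarrow> 'a list set" where
  "chains_from E b = {xs. \<exists>q. chain E b q xs}"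

definition homotopy_rel :: "('a \<times> 'a) set \<Rightarrow> 'a \<Rightarrow> ('a list \<times> 'a list) set" where
  "homotopy_rel E b =
     {(xs, ys). xs \<in> chains_from E b \<and> ys \<in> chains_from E b \<and> equivclp (chain_insert E) xs ys}"

definition chain_space :: "('a \<times> 'a) set \<Rightarrow> 'a \<Rightarrow> 'a list set set" where
  "chain_space E b = chains_from E b // homotopy_rel E b"

text \<open>
  The map \<open>X\<^sub>D \<rightarrow> X\<^sub>E\<close> for \<open>D \<subseteq> E\<close>: the saturation of a class for \<open>D\<close> under homotopy for \<open>E\<close>
  (see \<open>bonding_class\<close> below).
\<close>

definition bonding :: "'a \<Rightarrow> ('a \<times> 'a) set \<Rightarrow> 'a list set \<Rightarrow> 'a list set" where
  "bonding b E c = homotopy_rel E b `` c"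

lemma equiv_homotopy_rel: "equiv (chains_from E b) (homotopy_rel E b)"
proof (rule equivI)
  show "refl_on (chains_from E b) (homotopy_rel E b)"
    by (auto simp: refl_on_def homotopy_rel_def)
  show "sym (homotopy_rel E b)"
    by (auto simp: sym_def homotopy_rel_def intro: equivclp_sym)
  show "trans (homotopy_rel E b)"
    by (auto simp: trans_def homotopy_rel_def intro: equivclp_trans)
qed (auto simp: homotopy_rel_def)

lemma chain_mono: "D \<subseteq> E \<Longrightarrow> chain D p q xs \<Longrightarrow> chain E p q xs"
  unfolding chain_def by (auto elim!: successively_mono)

lemma homotopy_rel_mono:
  assumes "D \<subseteq> E" shows "homotopy_rel D b \<subseteq> homotopy_rel E b"
proof -
  have "chain_insert D \<le> chain_insert E"
    using chain_mono[OF assms] unfolding chain_insert_def by blast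
  then have "equivclp (chain_insert E) xs ys" if "equivclp (chain_insert D) xs ys" for xs ys
    using that unfolding equivclp_def symclp_def
    by (elim rtranclp_mono[THEN predicate2D, rotated]) auto
  moreover have "chains_from D b \<subseteq> chains_from E b"
    using chain_mono[OF assms] unfolding chains_from_def by blast
  ultimately show ?thesis
    unfolding homotopy_rel_def by blast
qed

lemma bonding_class:
  assumes "D \<subseteq> E" and "xs \<in> chains_from D b"
  shows "bonding b E (homotopy_rel D b `` {xs}) = homotopy_rel E b `` {xs}"
proof -
  have "(xs, xs) \<in> homotopy_rel D b"
    using assms(2) equiv_homotopy_rel by (metis equiv_class_self Image_singleton_iff)
  moreover have "trans (homotopy_rel E b)"
    using equiv_homotopy_rel by (metis equiv_def)
  ultimately show ?thesis
    using homotopy_rel_mono[OF assms(1)] unfolding bonding_def by (blast dest: transD)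
qed


subsection \<open>The inverse limit and coverable spaces\<close>

text \<open>
  Only the underlying set of the inverse limit enters the notion of a coverable space.  The
  projection to the factor at \<open>E\<close> is evaluation at \<open>E\<close>.
\<close>

definition chain_limit :: "('a \<times> 'a) filter \<Rightarrow> 'a \<Rightarrow> (('a \<times> 'a) set \<Rightarrow> 'a list set) set" where
  "chain_limit U b =
     {f \<in> (\<Pi>\<^sub>E E \<in> {E. entourage U E}. chain_space E b).
        \<forall>D E. entourage U D \<longrightarrow> entourage U E \<longrightarrow> D \<subseteq> E \<longrightarrow> bonding b E (f D) = f E}"

definition coverable :: "('a \<times> 'a) filter \<Rightarrow> 'a \<Rightarrow> bool" where
  "coverable U b \<longleftrightarrow>
     (\<exists>\<B>. (\<forall>E\<in>\<B>. entourage U E) \<and>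
          (\<forall>D. entourage U D \<longrightarrow> (\<exists>E\<in>\<B>. E \<subseteq> D)) \<and>
          UNIV \<in> \<B> \<and>
          (\<forall>E\<in>\<B>. (\<lambda>f. f E) ` chain_limit U b = chain_space E b))"


subsection \<open>The uniformity of a compact Hausdorff space\<close>

definition compatible_uniformity :: "('a::topological_space \<times> 'a) filter \<Rightarrow> bool" where
  "compatible_uniformity U \<longleftrightarrow> class.uniform_space open U"

definition the_compatible_uniformity :: "('a::topological_space \<times> 'a) filter" where
  "the_compatible_uniformity = (THE U. compatible_uniformity U)"

lemma compatible_uniformity_eventually_nhds:
  fixes U :: "('a::topological_space \<times> 'a) filter"
  assumes "compatible_uniformity U"
  shows "eventually P (nhds x) \<longleftrightarrow> (\<forall>\<^sub>F (x', y) in U. x' = x \<longrightarrow> P y)"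
proof -
  interpret u: uniform_space "open" U
    using assms unfolding compatible_uniformity_def .
  have "class.topological_space (open :: 'a set \<Rightarrow> bool)"
    by unfold_locales
  then have "topological_space.nhds open = (nhds :: 'a \<Rightarrow> _)"
    by (simp add: fun_eq_iff nhds_def topological_space.nhds_def)
  then show ?thesis
    using u.eventually_nhds_uniformity[of P x] by simp
qed

lemma compact_ex1_compatible_uniformity:
  assumes cpt: "compact (UNIV :: 'a::t2_space set)"
  shows "\<exists>!U :: ('a \<times> 'a) filter. compatible_uniformity U"
proof -
  define N :: "('a \<times> 'a) filter" where "N = (SUP x. nhds (x, x))"
  have evN: "eventually P N \<longleftrightarrow> (\<forall>x. eventually P (nhds (x, x)))" for P
    unfolding N_def by (simp add: eventually_Sup)
  have square: "\<exists>A. open A \<and> x \<in> A \<and> (\<forall>y\<in>A. \<forall>z\<in>A. P (y, z))"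
    if ev: "eventually P (nhds (x, x))" for P and x :: 'a
  proof -
    obtain S where S: "open S" "(x, x) \<in> S" "\<forall>p\<in>S. P p"
      using ev unfolding eventually_nhds by blast
    obtain A B where AB: "open A" "open B" "(x, x) \<in> A \<times> B" "A \<times> B \<subseteq> S"
      by (rule open_prod_elim[OF S(1,2)])
    then have "open (A \<inter> B)" and "x \<in> A \<inter> B"
      by auto
    moreover have "\<forall>y\<in>A \<inter> B. \<forall>z\<in>A \<inter> B. P (y, z)"
      using AB(4) S(3) by blast
    ultimately show ?thesis by blast
  qed
  have shrink: "\<exists>B. open B \<and> x \<in> B \<and> closure B \<subseteq> A" if "open A" "x \<in> A" for x :: 'a and A
  proof -
    have cA: "compact (- A)"
      using cpt \<open>open A\<close> compact_Int_closed[of UNIV "- A"] by (simp add: closed_Compl)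
    have "\<exists>V. open V \<and> y \<in> V \<and> x \<notin> closure V" if "y \<in> - A" for y
    proof -
      have "x \<noteq> y" using that \<open>x \<in> A\<close> by blast
      then obtain V W where "open V" "open W" "y \<in> V" "x \<in> W" "V \<inter> W = {}"
        by (metis hausdorff)
      moreover have "W \<inter> closure V = {}"
        using open_Int_closure_eq_empty[OF \<open>open W\<close>, of V] \<open>V \<inter> W = {}\<close> by blast
      ultimately show ?thesis by blast
    qed
    then obtain V where V: "\<And>y. y \<in> - A \<Longrightarrow> open (V y) \<and> y \<in> V y \<and> x \<notin> closure (V y)"
      by metis
    obtain Y where Y: "Y \<subseteq> - A" "finite Y" "- A \<subseteq> (\<Union>y\<in>Y. V y)"
      by (rule compactE_image[OF cA, of "- A" V]) (use V in auto)
    define B where "B = - (\<Union>y\<in>Y. closure (V y))"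
    have "open B"
      unfolding B_def using Y(2) by (intro open_Compl closed_UN) auto
    moreover have "x \<in> B"
      unfolding B_def using V Y(1) by auto
    moreover have "closure B \<subseteq> A"
    proof -
      have "B \<subseteq> - (\<Union>y\<in>Y. V y)"
        unfolding B_def using closure_subset by blast
      moreover have "open (\<Union>y\<in>Y. V y)"
        using V Y(1) by (intro open_UN) auto
      ultimately have "closure B \<subseteq> - (\<Union>y\<in>Y. V y)"
        by (intro closure_minimal closed_Compl)
      also have "\<dots> \<subseteq> A"
        using Compl_anti_mono[OF Y(3)] by simp
      finally show ?thesis .
    qed
    ultimately show ?thesis by blast
  qed
  have "compatible_uniformity N"
    unfolding compatible_uniformity_def
  proof (unfold_locales, goal_cases)
    case (1 S)
    show ?case
    proof
      assume S: "open S"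
      show "\<forall>x\<in>S. \<forall>\<^sub>F (x', y) in N. x' = x \<longrightarrow> y \<in> S"
      proof
        fix x assume "x \<in> S"
        have "open ((- {x}) \<times> UNIV \<union> UNIV \<times> S)"
          using S by (intro open_Un open_Times) auto
        then have *: "\<forall>\<^sub>F p in nhds (z, z). p \<in> (- {x}) \<times> UNIV \<union> UNIV \<times> S" for z
          using \<open>x \<in> S\<close> by (intro eventually_nhds_in_open) auto
        show "\<forall>\<^sub>F (x', y) in N. x' = x \<longrightarrow> y \<in> S"
          unfolding evN by (intro allI eventually_mono[OF *]) auto
      qed
    next
      assume *: "\<forall>x\<in>S. \<forall>\<^sub>F (x', y) in N. x' = x \<longrightarrow> y \<in> S"
      show "open S"
      proof (subst open_subopen, intro ballI)
        fix x assume "x \<in> S"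
        with * have "\<forall>\<^sub>F (x', y) in nhds (x, x). x' = x \<longrightarrow> y \<in> S"
          unfolding evN by blast
        from square[OF this] show "\<exists>T. open T \<and> x \<in> T \<and> T \<subseteq> S"
          by auto
      qed
    qed
  next
    case (2 E x)
    then show ?case unfolding evN by (blast dest: eventually_nhds_x_imp_x)
  next
    case (3 E)
    show ?case unfolding evN
    proof
      fix x :: 'a
      from 3 have "eventually E (nhds (x, x))" unfolding evN by blast
      from square[OF this] obtain A where "open A" "x \<in> A" "\<forall>y\<in>A. \<forall>z\<in>A. E (y, z)" by blast
      then show "\<forall>\<^sub>F (x, y) in nhds (x, x). E (y, x)"
        unfolding eventually_nhds by (intro exI[of _ "A \<times> A"]) (auto intro: open_Times)
    qed
  next
    case (4 E)
    then have "\<forall>x. \<exists>A. open A \<and> x \<in> A \<and> (\<forall>y\<in>A. \<forall>z\<in>A. E (y, z))"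
      unfolding evN using square by blast
    then obtain A where A: "\<And>x. open (A x)" "\<And>x. x \<in> A x"
        "\<And>x y z. y \<in> A x \<Longrightarrow> z \<in> A x \<Longrightarrow> E (y, z)"
      by metis
    have "\<forall>x. \<exists>B. open B \<and> x \<in> B \<and> closure B \<subseteq> A x"
      using shrink A(1,2) by blast
    then obtain B where B: "\<And>x. open (B x)" "\<And>x. x \<in> B x" "\<And>x. closure (B x) \<subseteq> A x"
      by metis
    obtain Y where Y: "finite Y" "UNIV \<subseteq> (\<Union>y\<in>Y. B y)"
      by (rule compactE_image[OF cpt, of UNIV B]) (use B in auto)
    define W where "W = (\<Inter>i\<in>Y. A i \<times> A i \<union> (- closure (B i)) \<times> (- closure (B i)))"
    have "open W"
      unfolding W_def using Y(1) A(1) by (intro open_INT ballI open_Un open_Times open_Compl) auto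
    moreover have "(z, z) \<in> W" for z
      unfolding W_def using B(3) by blast
    ultimately have "\<forall>\<^sub>F p in N. p \<in> W"
      unfolding evN by (auto intro: eventually_nhds_in_open)
    moreover have "E (x, z)" if "(x, y) \<in> W" "(y, z) \<in> W" for x y z
    proof -
      obtain i where i: "i \<in> Y" "y \<in> B i" using Y(2) by blast
      then have "y \<in> closure (B i)" using closure_subset by blast
      then show ?thesis
        using i that A(3)[of x i z] unfolding W_def by blast
    qed
    ultimately show ?case
      by (intro exI[of _ "\<lambda>p. p \<in> W"]) blast
  qed
  moreover have "U = N" if U: "compatible_uniformity U" for U :: "('a \<times> 'a) filter"
  proof -
    interpret u: uniform_space "open" U
      using U unfolding compatible_uniformity_def .
    note nhdsU = compatible_uniformity_eventually_nhds[OF U]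
    show ?thesis
    proof (rule antisym)
      show "U \<le> N"
      proof (rule filter_leI)
        fix P assume "eventually P N"
        then have "\<forall>x. \<exists>A. open A \<and> x \<in> A \<and> (\<forall>y\<in>A. \<forall>z\<in>A. P (y, z))"
          unfolding evN using square by blast
        then obtain A where A: "\<And>x. open (A x)" "\<And>x. x \<in> A x"
            "\<And>x y z. y \<in> A x \<Longrightarrow> z \<in> A x \<Longrightarrow> P (y, z)"
          by metis
        have "\<exists>D. eventually D U \<and> (\<forall>y z. D (x, y) \<longrightarrow> D (y, z) \<longrightarrow> z \<in> A x)" for x
        proof -
          have "\<forall>\<^sub>F (x', y) in U. x' = x \<longrightarrow> y \<in> A x"
            using A(1,2) u.open_uniformity by blast
          from u.uniformity_trans[OF this] show ?thesis by auto
        qed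
        then obtain D where D: "\<And>x. eventually (D x) U"
            "\<And>x y z. D x (x, y) \<Longrightarrow> D x (y, z) \<Longrightarrow> z \<in> A x"
          by metis
        have "\<exists>B. open B \<and> x \<in> B \<and> (\<forall>y\<in>B. D x (x, y))" for x
        proof -
          have "\<forall>\<^sub>F y in nhds x. D x (x, y)"
            unfolding nhdsU using D(1)[of x] by (rule eventually_mono) auto
          then show ?thesis unfolding eventually_nhds .
        qed
        then obtain B where B: "\<And>x. open (B x)" "\<And>x. x \<in> B x" "\<And>x y. y \<in> B x \<Longrightarrow> D x (x, y)"
          by metis
        obtain Y where Y: "finite Y" "UNIV \<subseteq> (\<Union>y\<in>Y. B y)"
          by (rule compactE_image[OF cpt, of UNIV B]) (use B in auto)
        have "\<forall>\<^sub>F p in U. \<forall>i\<in>Y. D i p"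
          using Y(1) D(1) by (simp add: eventually_ball_finite)
        then show "eventually P U"
        proof (rule eventually_mono)
          fix p assume *: "\<forall>i\<in>Y. D i p"
          obtain y z where p: "p = (y, z)" by fastforce
          obtain i where i: "i \<in> Y" "y \<in> B i" using Y(2) by blast
          have "z \<in> A i" using D(2) B(3) i * p by blast
          moreover have "y \<in> A i"
            using D(2)[of i y y] B(3)[OF i(2)] u.uniformity_refl[OF D(1)] by blast
          ultimately show "P p" using A(3) p by blast
        qed
      qed
      show "N \<le> U"
      proof (rule filter_leI)
        fix P assume "eventually P U"
        then obtain D0 where D0: "eventually D0 U"
            "\<And>x y z. D0 (x, y) \<Longrightarrow> D0 (y, z) \<Longrightarrow> P (x, z)"
          using u.uniformity_trans by blast
        show "eventually P N"
          unfolding evN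
        proof
          fix x
          have 1: "\<forall>\<^sub>F y in nhds x. D0 (x, y)"
            unfolding nhdsU using D0(1) by (rule eventually_mono) auto
          have 2: "\<forall>\<^sub>F y in nhds x. D0 (y, x)"
            unfolding nhdsU using u.uniformity_sym[OF D0(1)] by (rule eventually_mono) auto
          show "eventually P (nhds (x, x))"
            unfolding nhds_prod eventually_prod_filter
            using 1 2 D0(2) by blast
        qed
      qed
    qed
  qed
  ultimately show ?thesis by blast
qed

end

theory Submission
  imports Defs
begin

text \<open>
  Let \<open>E\<close> be an entourage all of whose balls are path connected.  The projection from the inverse
  limit to \<open>X\<^sub>E\<close> is surjective because an \<open>E\<close>-chain can be replaced by a path, and a path can be
  sampled as finely as desired.  In detail, consecutive points \<open>x, y\<close> of an \<open>E\<close>-chain both lie in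
  the ball of \<open>x\<close>, hence are joined by a path in that ball.  For every entourage \<open>D\<close> such a path has
  a subdivision that is fine enough for the sampled points to form a \<open>D\<close>-chain.  Any two such
  subdivisions have a common refinement, and refining by one point is an elementary homotopy
  (\<open>homotopic_meshes\<close>), so the \<open>D\<close>-class does not depend on the subdivision and the classes for
  varying \<open>D\<close> are compatible (\<open>coherent_chains_path\<close>).  Concatenating these families along the
  chain gives an element of the inverse limit (\<open>ex_coherent_chains\<close>).  Its value at \<open>E\<close> is the
  class of the given chain, because samples taken inside the ball of \<open>x\<close> can be deleted one after
  the other (\<open>chain_in_ball_homotopic\<close>).

  Uniform local path connectedness says in particular that such \<open>E\<close> form a base of the uniformity.
  The entourage \<open>X \<times> X\<close> is among them exactly if \<open>X\<close> is path connected, and this is where the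
  connectedness of \<open>X\<close> enters (\<open>connected_imp_path_connected\<close>).

  If \<open>X\<close> is compact and locally path connected, cover the diagonal by squares \<open>V \<times> V\<close> with \<open>V\<close> open,
  path connected and so small that \<open>V \<times> V\<close> is contained in a given entourage.  By compactness the
  union of the squares is an entourage, and its ball at \<open>x\<close> is the union of the sets \<open>V\<close> that
  contain \<open>x\<close>, which is open and path connected.  So \<open>X\<close> is uniformly locally path connected.
\<close>


section \<open>Homotopies of chains\<close>

lemma chain_append:
  assumes "chain E p q xs" "chain E q r ys" "(q, q) \<in> E"
  shows "chain E p r (xs @ ys)"
  using assms by (auto simp: chain_def successively_append_iff)

lemma chain_insert_append_right:
  assumes "chain_insert E xs ys" "chain E q r zs" "(q, q) \<in> E" "last xs = q"
  shows "chain_insert E (xs @ zs) (ys @ zs)"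
proof -
  from assms(1) obtain p q' us y ws
    where *: "chain E p q' xs" "chain E p q' ys" "xs = us @ ws" "ys = us @ [y] @ ws"
    unfolding chain_insert_def by blast
  have "q' = q"
    using *(1) assms(4) by (simp add: chain_def)
  then have "chain E p r (xs @ zs)" "chain E p r (ys @ zs)"
    using *(1,2) assms(2,3) by (metis chain_append)+
  moreover have "xs @ zs = us @ (ws @ zs)" "ys @ zs = us @ [y] @ (ws @ zs)"
    using *(3,4) by auto
  ultimately show ?thesis
    unfolding chain_insert_def by blast
qed

lemma chain_insert_append_left:
  assumes "chain_insert E xs ys" "chain E r q zs" "(q, q) \<in> E" "hd xs = q"
  shows "chain_insert E (zs @ xs) (zs @ ys)"
proof -
  from assms(1) obtain q' p us y ws
    where *: "chain E q' p xs" "chain E q' p ys" "xs = us @ ws" "ys = us @ [y] @ ws"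
    unfolding chain_insert_def by blast
  have "q' = q"
    using *(1) assms(4) by (simp add: chain_def)
  then have "chain E r p (zs @ xs)" "chain E r p (zs @ ys)"
    using *(1,2) assms(2,3) by (metis chain_append)+
  moreover have "zs @ xs = (zs @ us) @ ws" "zs @ ys = (zs @ us) @ [y] @ ws"
    using *(3,4) by auto
  ultimately show ?thesis
    unfolding chain_insert_def by blast
qed

lemma homotopic_ends:
  assumes "equivclp (chain_insert E) xs ys"
  shows "hd ys = hd xs \<and> last ys = last xs"
  using assms by induction (auto simp: chain_insert_def chain_def)

text \<open>
  Concatenation repeats the common end \<open>q\<close>, which is harmless as \<open>(q, q) \<in> E\<close>.  An elementary
  homotopy of one part is an elementary homotopy of the whole since it moves neither end of the part.
\<close>

lemma homotopic_append:
  assumes "equivclp (chain_insert E) xs xs'" "equivclp (chain_insert E) ys ys'"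
    and "chain E p q xs'" "chain E q r ys" "(q, q) \<in> E"
  shows "equivclp (chain_insert E) (xs @ ys) (xs' @ ys')"
proof -
  have "last xs = q"
    using homotopic_ends[OF assms(1)] assms(3) by (simp add: chain_def)
  have "equivclp (chain_insert E) (xs @ ys) (xs' @ ys)"
    using assms(1)
  proof induction
    case (step us vs)
    have "last us = q" "last vs = q"
      using homotopic_ends[OF step(1)] step(2) \<open>last xs = q\<close> by (auto simp: chain_insert_def chain_def)
    with step(2) have "chain_insert E (us @ ys) (vs @ ys) \<or> chain_insert E (vs @ ys) (us @ ys)"
      using chain_insert_append_right[OF _ assms(4,5)] by blast
    with step(3) show ?case
      by (rule equivclp_into_equivclp)
  qed simp
  also have "equivclp (chain_insert E) (xs' @ ys) (xs' @ ys')"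
    using assms(2)
  proof induction
    case (step us vs)
    have "hd us = q" "hd vs = q"
      using homotopic_ends[OF step(1)] step(2) assms(4) by (auto simp: chain_insert_def chain_def)
    with step(2) have "chain_insert E (xs' @ us) (xs' @ vs) \<or> chain_insert E (xs' @ vs) (xs' @ us)"
      using chain_insert_append_left[OF _ assms(3,5)] by blast
    with step(3) show ?case
      by (rule equivclp_into_equivclp)
  qed simp
  finally show ?thesis .
qed

text \<open>
  The last point of the first chain is related to every point of the second, so the points of the
  second chain can be removed in order, starting with the first one.
\<close>

lemma chain_in_ball_homotopic:
  assumes "chain E p q xs" "ys \<noteq> []" "set ys \<subseteq> eball q E" "successively (\<lambda>x y. (x, y) \<in> E) ys"
  shows "equivclp (chain_insert E) (xs @ ys) (xs @ [last ys])"
  using assms(2-4)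
proof (induction ys rule: induct_list012)
  case (3 x y zs)
  have "chain E p (last (y # zs)) (xs @ [x] @ (y # zs))" "chain E p (last (y # zs)) (xs @ (y # zs))"
    using 3(4,5) assms(1) by (auto simp: chain_def eball_def successively_append_iff)
  then have "chain_insert E (xs @ (y # zs)) (xs @ [x] @ (y # zs))"
    unfolding chain_insert_def by blast
  then have "equivclp (chain_insert E) (xs @ [x] @ (y # zs)) (xs @ (y # zs))"
    by (rule converse_r_into_equivclp)
  also have "equivclp (chain_insert E) (xs @ (y # zs)) (xs @ [last (y # zs)])"
    using 3 by (intro 3(2)) auto
  finally show ?case by simp
qed auto


section \<open>Compatible uniformities\<close>

lemma entourage_refl:
  assumes "compatible_uniformity U" "entourage U E"
  shows "(x, x) \<in> E"
proof -
  interpret u: uniform_space "open" U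
    using assms(1) unfolding compatible_uniformity_def .
  show ?thesis
    using assms(2) u.uniformity_refl[of "\<lambda>p. p \<in> E"] by (simp add: entourage_def)
qed

lemma eventually_small_nhds:
  fixes U :: "('a::topological_space \<times> 'a) filter"
  assumes U: "compatible_uniformity U" and E: "eventually E U"
  shows "\<exists>S. open S \<and> x \<in> S \<and> (\<forall>y\<in>S. \<forall>z\<in>S. E (y, z))"
proof -
  interpret u: uniform_space "open" U
    using U unfolding compatible_uniformity_def .
  obtain D where D: "eventually D U" "\<And>x y z. D (x, y) \<Longrightarrow> D (y, z) \<Longrightarrow> E (x, z)"
    using u.uniformity_trans[OF E] by blast
  have "\<forall>\<^sub>F y in nhds x. D (x, y)"
    unfolding compatible_uniformity_eventually_nhds[OF U]
    using D(1) by (rule eventually_mono) auto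
  moreover have "\<forall>\<^sub>F y in nhds x. D (y, x)"
    unfolding compatible_uniformity_eventually_nhds[OF U]
    using u.uniformity_sym[OF D(1)] by (rule eventually_mono) auto
  ultimately have "\<forall>\<^sub>F y in nhds x. D (x, y) \<and> D (y, x)"
    by (rule eventually_conj)
  then show ?thesis
    unfolding eventually_nhds using D(2) by blast
qed


section \<open>Chains along a path\<close>

text \<open>
  The condition ranges over all \<open>u \<le> v\<close> with no point of \<open>T\<close> strictly between them, rather than
  over consecutive points of \<open>T\<close>.  This controls \<open>g\<close> on each whole subinterval, so that it is
  inherited by larger \<open>T\<close>, whereas the sampled points of a larger \<open>T\<close> could otherwise be far apart.
\<close>

definition mesh :: "(real \<Rightarrow> 'a) \<Rightarrow> ('a \<times> 'a) set \<Rightarrow> real \<Rightarrow> real \<Rightarrow> real set \<Rightarrow> bool" where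
  "mesh g E a b T \<longleftrightarrow> finite T \<and> {a, b} \<subseteq> T \<and> T \<subseteq> {a..b} \<and>
     (\<forall>u\<in>{a..b}. \<forall>v\<in>{a..b}. u \<le> v \<longrightarrow> {u<..<v} \<inter> T = {} \<longrightarrow> (g u, g v) \<in> E)"

lemma mesh_mono: "mesh g D a b T \<Longrightarrow> D \<subseteq> E \<Longrightarrow> mesh g E a b T"
  unfolding mesh_def by blast

lemma mesh_insert: "mesh g E a b T \<Longrightarrow> t \<in> {a..b} \<Longrightarrow> mesh g E a b (insert t T)"
  unfolding mesh_def by blast

lemma successively_no_entry_between:
  fixes ts :: "'a::linorder list"
  assumes "sorted_wrt (<) ts"
  shows "successively (\<lambda>s t. s < t \<and> {s<..<t} \<inter> set ts = {}) ts"
  using assms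
proof (induction ts)
  case (Cons x ts)
  have "successively (\<lambda>s t. s < t \<and> {s<..<t} \<inter> set (x # ts) = {}) ts"
    using Cons by (auto elim!: successively_mono)
  moreover have "x < hd ts \<and> {x<..<hd ts} \<inter> set (x # ts) = {}" if "ts \<noteq> []"
    using Cons.prems that by (cases ts) auto
  ultimately show ?case
    unfolding successively_Cons by blast
qed simp

lemma chain_mesh:
  assumes "mesh g E a b T"
  shows "chain E (g a) (g b) (map g (sorted_list_of_set T))"
proof -
  define ts where "ts = sorted_list_of_set T"
  have ts: "sorted_wrt (<) ts" "set ts = T"
    using assms unfolding ts_def mesh_def by auto
  have ab: "a \<in> set ts" "b \<in> set ts" "set ts \<subseteq> {a..b}"
    using assms ts unfolding mesh_def by auto
  then have ne: "ts \<noteq> []" by auto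
  have "hd ts \<le> a"
    using ts(1) ab(1) by (cases ts) auto
  then have hd: "hd ts = a"
    using ab(3) ne by (meson atLeastAtMost_iff hd_in_set in_mono order_antisym)
  have "b \<le> last ts"
    using ts(1) ab(2) ne by (cases ts rule: rev_cases) (auto simp: sorted_wrt_append)
  then have last: "last ts = b"
    using ab(3) ne by (meson atLeastAtMost_iff last_in_set in_mono order_antisym)
  have "successively (\<lambda>s t. (g s, g t) \<in> E) ts"
    using successively_no_entry_between[OF ts(1)]
  proof (rule successively_mono)
    fix s t assume "s \<in> set ts" "t \<in> set ts" "s < t \<and> {s<..<t} \<inter> set ts = {}"
    then show "(g s, g t) \<in> E"
      using assms ab(3) ts(2) unfolding mesh_def by (meson in_mono less_imp_le)
  qed
  then show ?thesis
    using ne hd last unfolding chain_def ts_def[symmetric]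
    by (simp add: hd_map last_map successively_map)
qed

lemma insort_splits:
  "\<exists>us ws. xs = us @ ws \<and> insort x xs = us @ [x] @ ws"
proof (induction xs)
  case (Cons y xs)
  then obtain us ws where "xs = us @ ws" "insort x xs = us @ [x] @ ws" by blast
  then have "y # xs = (y # us) @ ws" "y # insort x xs = (y # us) @ [x] @ ws" by auto
  moreover have "y # xs = [] @ (y # xs)" "x # y # xs = [] @ [x] @ (y # xs)" by auto
  ultimately show ?case
    by (metis insort_key.simps(2))
qed simp

text \<open>
  The points of \<open>S\<close> are added one at a time; every set on the way is again a mesh, so each addition
  inserts a single point into an \<open>E\<close>-chain and leaves an \<open>E\<close>-chain.
\<close>

lemma homotopic_mesh_Un:
  assumes "mesh g E a b T" "finite S" "S \<subseteq> {a..b}"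
  shows "mesh g E a b (T \<union> S) \<and>
    equivclp (chain_insert E) (map g (sorted_list_of_set T)) (map g (sorted_list_of_set (T \<union> S)))"
  using assms(2,3)
proof induction
  case empty
  then show ?case using assms(1) by simp
next
  case (insert t S)
  let ?R = "T \<union> S"
  have m: "mesh g E a b ?R" and
    h: "equivclp (chain_insert E) (map g (sorted_list_of_set T)) (map g (sorted_list_of_set ?R))"
    using insert by auto
  have m': "mesh g E a b (insert t ?R)"
    using m insert by (intro mesh_insert) auto
  show ?case
  proof (cases "t \<in> ?R")
    case True
    then have "T \<union> insert t S = ?R" by auto
    then show ?thesis using m h by simp
  next
    case False
    have "finite ?R"
      using m by (simp add: mesh_def)
    with False have "sorted_list_of_set (insert t ?R) = insort t (sorted_list_of_set ?R)"
      by simp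
    then obtain us ws where "sorted_list_of_set ?R = us @ ws"
        "sorted_list_of_set (insert t ?R) = us @ [t] @ ws"
      using insort_splits[of "sorted_list_of_set ?R" t] by auto
    then have "map g (sorted_list_of_set ?R) = map g us @ map g ws"
        "map g (sorted_list_of_set (insert t ?R)) = map g us @ [g t] @ map g ws"
      by auto
    then have "chain_insert E (map g (sorted_list_of_set ?R)) (map g (sorted_list_of_set (insert t ?R)))"
      using chain_mesh[OF m] chain_mesh[OF m'] unfolding chain_insert_def by blast
    with h have "equivclp (chain_insert E) (map g (sorted_list_of_set T))
        (map g (sorted_list_of_set (insert t ?R)))"
      by (blast intro: equivclp_into_equivclp)
    then show ?thesis
      using m' by simp
  qed
qed

text \<open>Both meshes are homotopic to their common refinement.\<close>

lemma homotopic_meshes: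
  assumes "mesh g E a b S" "mesh g E a b T"
  shows "equivclp (chain_insert E) (map g (sorted_list_of_set S)) (map g (sorted_list_of_set T))"
proof -
  have "finite S" "S \<subseteq> {a..b}" "finite T" "T \<subseteq> {a..b}"
    using assms by (auto simp: mesh_def)
  then have "equivclp (chain_insert E) (map g (sorted_list_of_set S)) (map g (sorted_list_of_set (S \<union> T)))"
    "equivclp (chain_insert E) (map g (sorted_list_of_set T)) (map g (sorted_list_of_set (T \<union> S)))"
    using homotopic_mesh_Un assms by blast+
  then show ?thesis
    by (metis Un_commute equivclp_sym equivclp_trans)
qed

text \<open>
  Meshes of adjacent intervals combine to a mesh of their union, and by continuity a short interval
  around any point has the mesh consisting of its two ends.  Bisection does the rest.
\<close>

lemma ex_mesh:
  fixes g :: "real \<Rightarrow> 'a::topological_space"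
  assumes U: "compatible_uniformity U" and E: "entourage U E"
    and g: "continuous_on {a..b} g" and "a \<le> b"
  shows "\<exists>T. mesh g E a b T"
proof -
  define P where "P c d \<longleftrightarrow> (a \<le> c \<and> c \<le> d \<and> d \<le> b \<longrightarrow> (\<exists>T. mesh g E c d T))" for c d
  have "P a b"
    using \<open>a \<le> b\<close>
  proof (induction rule: Bolzano)
    case (trans c d e)
    show ?case
      unfolding P_def
    proof
      assume *: "a \<le> c \<and> c \<le> e \<and> e \<le> b"
      obtain S T where S: "mesh g E c d S" and T: "mesh g E d e T"
        using trans * unfolding P_def by (meson order_trans)
      have "(g u, g v) \<in> E" if uv: "u \<in> {c..e}" "v \<in> {c..e}" "u \<le> v" "{u<..<v} \<inter> (S \<union> T) = {}" for u v
      proof -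
        have "d \<in> S" using S by (simp add: mesh_def)
        then have "d \<notin> {u<..<v}" using uv(4) by blast
        then have "v \<le> d \<or> d \<le> u" by auto
        then show ?thesis
        proof
          assume "v \<le> d"
          then have "u \<in> {c..d}" "v \<in> {c..d}" "{u<..<v} \<inter> S = {}" using uv by auto
          with S uv(3) show ?thesis unfolding mesh_def by blast
        next
          assume "d \<le> u"
          then have "u \<in> {d..e}" "v \<in> {d..e}" "{u<..<v} \<inter> T = {}" using uv by auto
          with T uv(3) show ?thesis unfolding mesh_def by blast
        qed
      qed
      then have "mesh g E c e (S \<union> T)"
        using S T trans(3,4) unfolding mesh_def by fastforce
      then show "\<exists>T. mesh g E c e T" by blast
    qed
  next
    case (local x)
    obtain S where S: "open S" "g x \<in> S" "\<And>y z. y \<in> S \<Longrightarrow> z \<in> S \<Longrightarrow> (y, z) \<in> E"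
      using eventually_small_nhds[OF U, of "\<lambda>p. p \<in> E" "g x"] E unfolding entourage_def by auto
    obtain A where A: "open A" "A \<inter> {a..b} = g -` S \<inter> {a..b}"
      using g S(1) unfolding continuous_on_open_invariant by blast
    have "x \<in> A"
    proof -
      have "x \<in> g -` S \<inter> {a..b}"
        using S(2) local by simp
      then show ?thesis
        unfolding A(2)[symmetric] by simp
    qed
    then obtain d where d: "d > 0" "ball x d \<subseteq> A"
      using A(1) openE by blast
    have "P c e" if "c \<le> x" "x \<le> e" "e - c < d" for c e
      unfolding P_def
    proof
      assume *: "a \<le> c \<and> c \<le> e \<and> e \<le> b"
      have "g u \<in> S" if "u \<in> {c..e}" for u
      proof -
        have "u \<in> ball x d"
          using that \<open>c \<le> x\<close> \<open>x \<le> e\<close> \<open>e - c < d\<close> by (auto simp: dist_real_def)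
        moreover have "u \<in> {a..b}"
          using that * by auto
        ultimately show ?thesis using A(2) d(2) by blast
      qed
      then have "mesh g E c e {c, e}"
        using S(3) * unfolding mesh_def by auto
      then show "\<exists>T. mesh g E c e T" by blast
    qed
    with d(1) show ?case by blast
  qed
  then show ?thesis
    using \<open>a \<le> b\<close> by (simp add: P_def)
qed


section \<open>Coherent families of chains\<close>

text \<open>
  A coherent family represents an element of the inverse limit by a choice of chains.  Keeping
  representatives and both endpoints, instead of working with classes, is what makes it possible
  to concatenate families, which need not start at the basepoint.
\<close>

definition coherent_chains ::
  "('a \<times> 'a) filter \<Rightarrow> 'a \<Rightarrow> 'a \<Rightarrow> (('a \<times> 'a) set \<Rightarrow> 'a list) \<Rightarrow> bool" where
  "coherent_chains U p q L \<longleftrightarrow>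
     (\<forall>E. entourage U E \<longrightarrow> chain E p q (L E)) \<and>
     (\<forall>D E. entourage U D \<longrightarrow> entourage U E \<longrightarrow> D \<subseteq> E \<longrightarrow> equivclp (chain_insert E) (L D) (L E))"

lemma coherent_chains_const: "coherent_chains U p p (\<lambda>_. [p])"
  by (simp add: coherent_chains_def chain_def)

lemma coherent_chains_append:
  assumes U: "compatible_uniformity U"
    and L: "coherent_chains U p q L" and M: "coherent_chains U q r M"
  shows "coherent_chains U p r (\<lambda>E. L E @ M E)"
  unfolding coherent_chains_def
proof (intro conjI allI impI)
  show "chain E p r (L E @ M E)" if "entourage U E" for E
    using that L M chain_append[OF _ _ entourage_refl[OF U that]] unfolding coherent_chains_def by blast
  show "equivclp (chain_insert E) (L D @ M D) (L E @ M E)"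
    if "entourage U D" "entourage U E" "D \<subseteq> E" for D E
  proof (rule homotopic_append[where p = p and q = q and r = r])
    show "chain E q r (M D)"
      using M that(1) by (intro chain_mono[OF that(3)]) (simp add: coherent_chains_def)
    show "(q, q) \<in> E"
      using entourage_refl[OF U that(2)] .
  qed (use L M that in \<open>simp_all add: coherent_chains_def\<close>)
qed

lemma coherent_chains_path:
  assumes U: "compatible_uniformity U" and g: "path g"
  shows "\<exists>L. coherent_chains U (pathstart g) (pathfinish g) L \<and>
           (\<forall>E. entourage U E \<longrightarrow> set (L E) \<subseteq> path_image g)"
proof -
  define T where "T E = (SOME T. mesh g E 0 1 T)" for E
  have T: "mesh g E 0 1 (T E)" if "entourage U E" for E
    unfolding T_def using g by (intro someI_ex[OF ex_mesh[OF U that]]) (simp_all add: path_def)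
  let ?L = "\<lambda>E. map g (sorted_list_of_set (T E))"
  have "coherent_chains U (pathstart g) (pathfinish g) ?L"
    unfolding coherent_chains_def pathstart_def pathfinish_def
    using chain_mesh[OF T] homotopic_meshes[OF mesh_mono[OF T] T] by simp
  moreover have "set (?L E) \<subseteq> path_image g" if "entourage U E" for E
    using T[OF that] by (auto simp: mesh_def path_image_def)
  ultimately show ?thesis by blast
qed

text \<open>
  Induction on the chain: the last step from \<open>z\<close> to \<open>y\<close> is replaced by the samples of a path in the
  ball at \<open>z\<close>, and these samples contract to \<open>y\<close> alone.
\<close>

lemma ex_coherent_chains:
  assumes U: "compatible_uniformity U" and E: "entourage U E"
    and balls: "\<And>x. path_connected (eball x E)"
    and "chain E p q xs"
  shows "\<exists>L. coherent_chains U p q L \<and> equivclp (chain_insert E) (L E) xs"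
proof -
  have refl: "(x, x) \<in> E" for x
    using entourage_refl[OF U E] .
  show ?thesis
    using \<open>chain E p q xs\<close>
  proof (induction xs arbitrary: q rule: rev_induct)
    case Nil
    then show ?case by (simp add: chain_def)
  next
    case (snoc y xs)
    show ?case
    proof (cases "xs = []")
      case True
      with snoc.prems have "p = y" "q = y" "xs @ [y] = [p]" by (auto simp: chain_def)
      then show ?thesis
        using coherent_chains_const[of U y] by (intro exI[of _ "\<lambda>_. [p]"]) auto
    next
      case False
      define z where "z = last xs"
      have xs: "chain E p z xs" and zy: "(z, y) \<in> E" and "q = y"
        using snoc.prems False by (auto simp: chain_def successively_append_iff z_def)
      obtain L where L: "coherent_chains U p z L" "equivclp (chain_insert E) (L E) xs"
        using snoc.IH[OF xs] by blast
      have "z \<in> eball z E" "y \<in> eball z E"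
        using refl zy by (auto simp: eball_def)
      then obtain g where g: "path g" "path_image g \<subseteq> eball z E" "pathstart g = z" "pathfinish g = y"
        using balls[of z] unfolding path_connected_def by blast
      obtain M where M: "coherent_chains U z y M" "set (M E) \<subseteq> eball z E"
        using coherent_chains_path[OF U g(1)] g(2-4) E by fastforce
      have ME: "chain E z y (M E)"
        using M(1) E by (simp add: coherent_chains_def)
      have "equivclp (chain_insert E) (L E @ M E) (xs @ M E)"
        using L(2) xs ME refl by (intro homotopic_append) auto
      also have "equivclp (chain_insert E) (xs @ M E) (xs @ [y])"
        using chain_in_ball_homotopic[OF xs, of "M E"] ME M(2) by (auto simp: chain_def)
      finally have "equivclp (chain_insert E) (L E @ M E) (xs @ [y])" .
      then show ?thesis
        using coherent_chains_append[OF U L(1) M(1)] \<open>q = y\<close> by blast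
    qed
  qed
qed

lemma projection_surjective:
  assumes U: "compatible_uniformity U" and E: "entourage U E"
    and balls: "\<And>x. path_connected (eball x E)"
  shows "(\<lambda>f. f E) ` chain_limit U b = chain_space E b"
proof
  show "(\<lambda>f. f E) ` chain_limit U b \<subseteq> chain_space E b"
    using E by (auto simp: chain_limit_def)
  show "chain_space E b \<subseteq> (\<lambda>f. f E) ` chain_limit U b"
  proof
    fix c assume "c \<in> chain_space E b"
    then obtain xs q where xs: "chain E b q xs" and c: "c = homotopy_rel E b `` {xs}"
      unfolding chain_space_def chains_from_def by (auto elim: quotientE)
    obtain L where L: "coherent_chains U b q L" and LE: "equivclp (chain_insert E) (L E) xs"
      using ex_coherent_chains[OF U E balls xs] by blast
    have from_b: "L D \<in> chains_from D b" if "entourage U D" for D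
      using L that unfolding coherent_chains_def chains_from_def by blast
    define f where "f = (\<lambda>D\<in>{D. entourage U D}. homotopy_rel D b `` {L D})"
    have "f \<in> chain_limit U b"
      unfolding chain_limit_def
    proof (intro CollectI conjI allI impI)
      show "f \<in> (\<Pi>\<^sub>E D \<in> {D. entourage U D}. chain_space D b)"
        unfolding f_def chain_space_def using from_b by (auto intro: quotientI)
      fix C D assume CD: "entourage U C" "entourage U D" "C \<subseteq> D"
      have "L C \<in> chains_from D b"
        using from_b[OF CD(1)] chain_mono[OF CD(3)] unfolding chains_from_def by blast
      moreover have "equivclp (chain_insert D) (L C) (L D)"
        using L CD unfolding coherent_chains_def by blast
      ultimately have "(L C, L D) \<in> homotopy_rel D b"
        using from_b[OF CD(2)] unfolding homotopy_rel_def by blast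
      then show "bonding b D (f C) = f D"
        using CD(1,2) bonding_class[OF CD(3) from_b[OF CD(1)]]
        by (simp add: f_def equiv_class_eq[OF equiv_homotopy_rel])
    qed
    moreover have "(L E, xs) \<in> homotopy_rel E b"
      using LE from_b[OF E] xs unfolding homotopy_rel_def chains_from_def by blast
    then have "f E = c"
      using E by (simp add: f_def c equiv_class_eq[OF equiv_homotopy_rel])
    ultimately show "c \<in> (\<lambda>f. f E) ` chain_limit U b" by blast
  qed
qed


section \<open>Coverable spaces\<close>

text \<open>The path components are open, and so are their complements, as unions of other components.\<close>

lemma connected_imp_path_connected:
  assumes conn: "connected (UNIV :: 'a::topological_space set)"
    and nbhd: "\<And>x::'a. \<exists>V. open V \<and> x \<in> V \<and> path_connected V"
  shows "path_connected (UNIV :: 'a set)"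
proof -
  have nbhd': "\<exists>V. open V \<and> x \<in> V \<and> (\<forall>y\<in>V. path_component UNIV x y)" for x :: 'a
    using nbhd[of x] path_component_of_subset[OF subset_UNIV]
    unfolding path_connected_component by meson
  have "path_component_set UNIV x = UNIV" for x :: 'a
  proof -
    let ?C = "path_component_set UNIV x"
    have "open ?C"
    proof (subst open_subopen, intro ballI)
      fix y assume y: "y \<in> ?C"
      obtain V where V: "open V" "y \<in> V" "\<forall>z\<in>V. path_component UNIV y z"
        using nbhd'[of y] by blast
      then have "V \<subseteq> ?C"
        using y path_component_trans[of UNIV x y] by auto
      with V show "\<exists>V. open V \<and> y \<in> V \<and> V \<subseteq> ?C" by blast
    qed
    moreover have "open (- ?C)"
    proof (subst open_subopen, intro ballI)
      fix y assume y: "y \<in> - ?C"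
      obtain V where V: "open V" "y \<in> V" "\<forall>z\<in>V. path_component UNIV y z"
        using nbhd'[of y] by blast
      then have "path_component UNIV x z \<Longrightarrow> z \<in> V \<Longrightarrow> path_component UNIV x y" for z
        using path_component_trans[of UNIV x z y] path_component_sym[of UNIV y z] by auto
      then have "V \<subseteq> - ?C"
        using y by auto
      with V show "\<exists>V. open V \<and> y \<in> V \<and> V \<subseteq> - ?C" by blast
    qed
    moreover have "x \<in> ?C"
      by (simp add: path_component_refl)
    ultimately show ?thesis
      using connectedD[OF conn, of ?C "- ?C"] by auto
  qed
  then show ?thesis
    unfolding path_connected_component by blast
qed

lemma uniformly_locally_path_connected_imp_coverable:
  fixes U :: "('a::topological_space \<times> 'a) filter"
  assumes U: "compatible_uniformity U" and conn: "connected (UNIV :: 'a set)"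
    and ulpc: "uniformly_locally_path_connected U"
  shows "coverable U b"
proof -
  (* Path connectedness of the space makes UNIV a member of the base of entourages with path
     connected balls. *)
  have UNIV: "entourage U UNIV"
    by (simp add: entourage_def sym_def)
  obtain F where "entourage U F" and F: "\<And>x. open (eball x F) \<and> path_connected (eball x F)"
    using ulpc UNIV unfolding uniformly_locally_path_connected_def by blast
  then have "x \<in> eball x F" for x
    using entourage_refl[OF U] by (auto simp: eball_def)
  then have "path_connected (UNIV :: 'a set)"
    using F connected_imp_path_connected[OF conn] by meson
  then have "path_connected (eball x UNIV)" for x :: 'a
    by (simp add: eball_def)
  then show ?thesis
    unfolding coverable_def
    using ulpc UNIV projection_surjective[OF U]
    by (intro exI[of _ "{E. entourage U E \<and> (\<forall>x. path_connected (eball x E))}"])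
      (auto simp: uniformly_locally_path_connected_def, meson)
qed

text \<open>
  A Lebesgue number argument: finitely many open sets \<open>B i\<close> cover the space, each so small that all
  points \<open>D i\<close>-close to a point of \<open>B i\<close> lie in \<open>V i\<close>.  A pair that is close for each of these
  finitely many \<open>D i\<close> therefore lies in the \<open>V i\<close> of a set \<open>B i\<close> that contains its first point.
\<close>

lemma compact_nhd_diagonal_eventually:
  fixes U :: "('a::topological_space \<times> 'a) filter"
  assumes cpt: "compact (UNIV :: 'a set)" and U: "compatible_uniformity U"
    and V: "\<And>x. open (V x)" "\<And>x. x \<in> V x"
  shows "\<forall>\<^sub>F (y, z) in U. \<exists>x. y \<in> V x \<and> z \<in> V x"
proof -
  interpret u: uniform_space "open" U
    using U unfolding compatible_uniformity_def .
  have "\<exists>D. eventually D U \<and> (\<forall>y z. D (x, y) \<longrightarrow> D (y, z) \<longrightarrow> z \<in> V x)" for x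
  proof -
    have "\<forall>\<^sub>F (x', y) in U. x' = x \<longrightarrow> y \<in> V x"
      using V u.open_uniformity by blast
    from u.uniformity_trans[OF this] show ?thesis by auto
  qed
  then obtain D where D: "\<And>x. eventually (D x) U"
      "\<And>x y z. D x (x, y) \<Longrightarrow> D x (y, z) \<Longrightarrow> z \<in> V x"
    by metis
  have "\<exists>B. open B \<and> x \<in> B \<and> (\<forall>y\<in>B. D x (x, y))" for x
  proof -
    have "\<forall>\<^sub>F y in nhds x. D x (x, y)"
      unfolding compatible_uniformity_eventually_nhds[OF U]
      using D(1)[of x] by (rule eventually_mono) auto
    then show ?thesis unfolding eventually_nhds .
  qed
  then obtain B where B: "\<And>x. open (B x)" "\<And>x. x \<in> B x" "\<And>x y. y \<in> B x \<Longrightarrow> D x (x, y)"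
    by metis
  obtain Y where Y: "finite Y" "UNIV \<subseteq> (\<Union>y\<in>Y. B y)"
    by (rule compactE_image[OF cpt, of UNIV B]) (use B in auto)
  have "\<forall>\<^sub>F p in U. \<forall>i\<in>Y. D i p"
    using Y(1) D(1) by (simp add: eventually_ball_finite)
  then show ?thesis
  proof (rule eventually_mono)
    fix p assume *: "\<forall>i\<in>Y. D i p"
    obtain y z where p: "p = (y, z)" by fastforce
    obtain i where i: "i \<in> Y" "y \<in> B i" using Y(2) by blast
    have "z \<in> V i" using D(2) B(3) i * p by blast
    moreover have "y \<in> V i"
      using D(2)[of i y y] B(3)[OF i(2)] u.uniformity_refl[OF D(1)] by blast
    ultimately show "case p of (y, z) \<Rightarrow> \<exists>x. y \<in> V x \<and> z \<in> V x" using p by blast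
  qed
qed

lemma locally_path_connected_open_subset:
  fixes S :: "'a::topological_space set"
  assumes lpc: "locally path_connected (UNIV :: 'a set)" and "open S" "x \<in> S"
  shows "\<exists>V. open V \<and> x \<in> V \<and> V \<subseteq> S \<and> path_connected V"
proof (intro exI conjI)
  show "open (path_component_set S x)"
    using locally_path_connected_2[OF lpc, unfolded subtopology_UNIV open_openin[symmetric]] assms(2,3) .
  show "x \<in> path_component_set S x"
    using assms(3) by (simp add: path_component_refl)
qed (rule path_component_subset path_connected_path_component)+

text \<open>
  A union of squares \<open>V \<times> V\<close> is automatically symmetric, and its ball at \<open>y\<close> is a union of path
  connected sets that share the point \<open>y\<close>.
\<close>

lemma compact_locally_path_connected_uniformly:
  fixes U :: "('a::topological_space \<times> 'a) filter"
  assumes cpt: "compact (UNIV :: 'a set)" and U: "compatible_uniformity U"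
    and lpc: "locally path_connected (UNIV :: 'a set)"
  shows "uniformly_locally_path_connected U"
  unfolding uniformly_locally_path_connected_def
proof (intro allI impI)
  fix E assume E: "entourage U E"
  have "\<exists>V. open V \<and> x \<in> V \<and> V \<times> V \<subseteq> E \<and> path_connected V" for x
  proof -
    obtain S where S: "open S" "x \<in> S" "\<And>y z. y \<in> S \<Longrightarrow> z \<in> S \<Longrightarrow> (y, z) \<in> E"
      using eventually_small_nhds[OF U, of "\<lambda>p. p \<in> E" x] E unfolding entourage_def by auto
    then show ?thesis
      using locally_path_connected_open_subset[OF lpc S(1,2)] by blast
  qed
  then obtain V where V: "\<And>x. open (V x)" "\<And>x. x \<in> V x" "\<And>x. V x \<times> V x \<subseteq> E"
      "\<And>x. path_connected (V x)"
    by metis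
  define F where "F = (\<Union>x. V x \<times> V x)"
  have "entourage U F"
    unfolding entourage_def
  proof
    show "\<forall>\<^sub>F p in U. p \<in> F"
      using compact_nhd_diagonal_eventually[OF cpt U V(1,2)]
      by (rule eventually_mono) (auto simp: F_def)
    show "sym F"
      by (auto simp: F_def sym_def)
  qed
  moreover have "F \<subseteq> E"
    using V(3) by (auto simp: F_def)
  moreover have "open (eball y F) \<and> path_connected (eball y F)" for y
  proof -
    have eq: "eball y F = \<Union> (V ` {x. y \<in> V x})"
      by (auto simp: eball_def F_def)
    have "path_component (eball y F) z w" if "z \<in> eball y F" "w \<in> eball y F" for z w
    proof -
      have "path_component (eball y F) y v" if v: "v \<in> eball y F" for v
      proof -
        obtain x where x: "y \<in> V x" "v \<in> V x" using v eq by auto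
        then have "path_component (V x) y v"
          using V(4) unfolding path_connected_component by blast
        then show ?thesis
          using path_component_of_subset[of "V x" "eball y F"] x(1) eq by blast
      qed
      with that show ?thesis
        using path_component_sym path_component_trans by metis
    qed
    then show ?thesis
      using eq V(1) by (auto simp: path_connected_component)
  qed
  ultimately show "\<exists>F. entourage U F \<and> F \<subseteq> E \<and> (\<forall>x. open (eball x F) \<and> path_connected (eball x F))"
    by blast
qed

theorem corollary74:
  fixes b :: "'a::uniform_space" and c :: "'b::t2_space"
  shows "(connected (UNIV :: 'a set) \<and>
            uniformly_locally_path_connected (uniformity :: ('a \<times> 'a) filter) \<longrightarrow>
            coverable uniformity b) \<and>
         (compact (UNIV :: 'b set) \<and> connected (UNIV :: 'b set) \<and>
            locally path_connected (UNIV :: 'b set) \<longrightarrow>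
            coverable the_compatible_uniformity c)"
proof (intro conjI impI; elim conjE)
  have "compatible_uniformity (uniformity :: ('a \<times> 'a) filter)"
    unfolding compatible_uniformity_def by (rule uniform_space_axioms)
  then show "coverable uniformity b"
    if "connected (UNIV :: 'a set)" "uniformly_locally_path_connected (uniformity :: ('a \<times> 'a) filter)"
    using that by (rule uniformly_locally_path_connected_imp_coverable)
next
  assume cpt: "compact (UNIV :: 'b set)" and conn: "connected (UNIV :: 'b set)"
    and lpc: "locally path_connected (UNIV :: 'b set)"
  have "compatible_uniformity (the_compatible_uniformity :: ('b \<times> 'b) filter)"
    unfolding the_compatible_uniformity_def by (rule theI'[OF compact_ex1_compatible_uniformity[OF cpt]])
  then show "coverable the_compatible_uniformity c"
    using uniformly_locally_path_connected_imp_coverable conn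
      compact_locally_path_connected_uniformly[OF cpt _ lpc] by blast
qed

end
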